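(* Let $n\ge 1$ be an integer. The following hold. (1) Let $G=\mathbb{R}^n\setminus\{z\}$ with $z\in\mathbb{R}^n$, let $x\in G$ and $r>0$. If $r\le 1/2$, then the metric ball $B_s(x,r)$ of $(G,s_G)$ is convex; if $r<1/2$, then $B_s(x,r)$ is strictly convex. (2) Let $G=\mathbb{H}^n$, $x=(x_1,\dots,x_n)\in G$ and $r\in(0,1)$. Then the metric ball $B_s(x,r)$ of $(G,s_G)$ satisfies $$B_s(x,r)=B^n\left(x-e_nx_n\left(1-\frac{1+r^2}{1-r^2}\right),\ \frac{2x_nr}{1-r^2}\right),$$ and $B_s(x,r)$ is thus strictly convex. (3) Let $G=\mathbb{H}^2\setminus\{e_2\}$, let $x=(x_1,x_2)\in G$ with $x_2<|x_1|$, and let $r\in(0,r_0]$, where $$r_0=\frac{\sqrt{x_1^2+x_2^2}-\sqrt{2}\,x_2}{|x_1|+x_2}.$$ Then the metric ball $B_s(x,r)$ of $(G,s_G)$ is convex. (4) Let $P\subset\mathbb{R}^2$ be a polygon and $x\in P$. Then the metric ball $B_s(x,r)$ of $(P,s_P)$ is convex for all $r\in(0,1/2]$. Moreover, if $P$ is convex, then $B_s(x,r)$ is convex for all $r\in(0,1)$.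
   Context: For an open set $G\subsetneq\mathbb{R}^n$ and $x,y\in G$, the triangular ratio metric is $$s_G(x,y)=\sup_{z\in\partial G}\frac{|x-y|}{|z-x|+|z-y|}\in[0,1],$$ where $|\cdot|$ is the Euclidean norm. For $x\in G$ and $r>0$, $B_s(x,r)=B_{s_G}(x,r)=\{y\in G: s_G(x,y)<r\}$. $B^n(a,\varrho)$ is the open Euclidean ball in $\mathbb{R}^n$ with center $a$ and radius $\varrho$. $\mathbb{H}^n=\{x\in\mathbb{R}^n: x_n>0\}$ is the upper half-space, and $e_n=(0,\dots,0,1)$ (so $e_2=(0,1)\in\mathbb{R}^2$). "Convex" and "strictly convex" are in the Euclidean sense; strictly convex means that for any two distinct points of the closure the open segment joining them lies in the interior. A polygon is understood as a domain: the bounded open region enclosed by a simple closed polygonal curve. *)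

theory Defs
  imports "HOL-Analysis.Analysis"
begin

(* Intended for x, y in an open set G that is neither empty nor the whole space: then the
   frontier is non-empty, the denominators are positive and the quotients are bounded by 1,
   so the conditionally complete supremum on the reals is the genuine one. *)
definition triangular_ratio :: "'a::real_normed_vector set \<Rightarrow> 'a \<Rightarrow> 'a \<Rightarrow> real" where
  "triangular_ratio G x y =
     (SUP z\<in>frontier G. norm (x - y) / (norm (z - x) + norm (z - y)))"

definition tr_ball :: "'a::real_normed_vector set \<Rightarrow> 'a \<Rightarrow> real \<Rightarrow> 'a set" where
  "tr_ball G x r = {y \<in> G. triangular_ratio G x y < r}"

definition strictly_convex :: "'a::real_normed_vector set \<Rightarrow> bool" where
  "strictly_convex S \<longleftrightarrow>
     (\<forall>x\<in>closure S. \<forall>y\<in>closure S. x \<noteq> y \<longrightarrow> open_segment x y \<subseteq> interior S)"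

(* A finite index type has no distinguished last element, so the coordinate k that is
   required to be positive is a parameter; in the plane, k = 2 is the last coordinate. *)
definition upper_half_space :: "'n::finite \<Rightarrow> (real ^ 'n) set" where
  "upper_half_space k = {x. 0 < x $ k}"

fun polygonal_path :: "'a::real_normed_vector list \<Rightarrow> real \<Rightarrow> 'a" where
  "polygonal_path [] = linepath 0 0"
| "polygonal_path [a] = linepath a a"
| "polygonal_path [a, b] = linepath a b"
| "polygonal_path (a # b # c # vs) = linepath a b +++ polygonal_path (b # c # vs)"

(* A closed curve repeats its initial vertex at the end of the vertex list.  A constant path
   is not simple, so vertex lists with fewer than two entries are excluded. *)
definition polygon :: "(real ^ 2) set \<Rightarrow> bool" where
  "polygon P \<longleftrightarrow>
     (\<exists>vs. simple_path (polygonal_path vs) \<and>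
           pathfinish (polygonal_path vs) = pathstart (polygonal_path vs) \<and>
           P = inside (path_image (polygonal_path vs)))"

end

(* As the infimum of |z - x| + |z - y| over the frontier is attained, tr_ball G x r is the
   intersection over the frontier points z of the Cartesian ovals |x - y| < r (|z - x| + |z - y|).
   With w = x - z and p = y - z, squaring turns the oval into F p < const, where
   F p = (1 - r^2)|p|^2 - 2 r^2 |w| |p| - 2 w.p is convex on the half-space
   w.p >= r^2 / (1 - r^2) |w|^2, which contains the oval as soon as r <= 1/2.
   For a half-space, reflecting y in the boundary makes the ball an Apollonian, hence Euclidean, ball,
   and a convex domain has the intersection of the balls of all half-spaces containing it.
   In the punctured half-plane, r <= r_0 says that the ball B of the half-plane lies in the sector
   y_2 < |y_1| containing x; there the frontier point (sgn x_1, 0) is closer than e_2, so the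
   puncture imposes no condition on B. *)
theory Submission
  imports Defs
begin

section \<open>Convex combinations and squared norms; strict convexity of Euclidean balls\<close>

lemma norm_convex_comb_power2:
  fixes p q :: "'a::real_inner"
  shows "(1 - s) * (norm p)\<^sup>2 + s * (norm q)\<^sup>2 - (norm ((1 - s) *\<^sub>R p + s *\<^sub>R q))\<^sup>2
    = s * (1 - s) * (norm (p - q))\<^sup>2"
  unfolding power2_norm_eq_inner
  by (simp add: inner_add inner_diff inner_commute) (simp add: algebra_simps)

text \<open>The identity above also holds for the reals \<open>norm p\<close> and
  \<open>norm q\<close>, with defect \<open>s * (1 - s) * (norm p - norm q)\<^sup>2\<close>.
  Subtracting the two identities leaves the defect of the vectors minus this nonnegative
  one.\<close>

lemma convex_comb_norm_power2_diff_le: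
  fixes p q :: "'a::real_inner"
  assumes "0 \<le> s" "s \<le> 1"
  shows "((1 - s) * norm p + s * norm q)\<^sup>2 - (norm ((1 - s) *\<^sub>R p + s *\<^sub>R q))\<^sup>2
    \<le> s * (1 - s) * (norm (p - q))\<^sup>2"
proof -
  have "s * (1 - s) * (norm p - norm q)\<^sup>2 \<ge> 0"
    using assms by simp
  then show ?thesis
    unfolding norm_convex_comb_power2[symmetric]
    by (simp add: power2_eq_square algebra_simps)
qed

lemma strictly_convex_ball:
  fixes c :: "'a::euclidean_space"
  assumes "0 < R"
  shows "strictly_convex (ball c R)"
  unfolding strictly_convex_def
proof (intro ballI impI subsetI)
  fix p q m
  assume pq: "p \<in> closure (ball c R)" "q \<in> closure (ball c R)" "p \<noteq> q"
    and m: "m \<in> open_segment p q"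
  obtain s where s: "0 < s" "s < 1" "m = (1 - s) *\<^sub>R p + s *\<^sub>R q"
    using m by (auto simp: in_segment)
  have *: "norm (p - c) \<le> R" "norm (q - c) \<le> R"
    using pq assms by (auto simp: dist_norm norm_minus_commute)
  have **: "m - c = (1 - s) *\<^sub>R (p - c) + s *\<^sub>R (q - c)"
    by (simp add: s algebra_simps)
  have "0 < s * (1 - s) * (norm ((p - c) - (q - c)))\<^sup>2"
    using s pq by simp
  then have "(norm (m - c))\<^sup>2 < (1 - s) * (norm (p - c))\<^sup>2 + s * (norm (q - c))\<^sup>2"
    unfolding ** norm_convex_comb_power2[symmetric] by simp
  also have "\<dots> \<le> (1 - s) * R\<^sup>2 + s * R\<^sup>2"
    using s * by (intro add_mono mult_left_mono power_mono) auto
  finally have "(norm (m - c))\<^sup>2 < R\<^sup>2"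
    by (simp add: algebra_simps)
  then have "norm (m - c) < R"
    using assms by (simp add: power2_less_imp_less)
  then show "m \<in> interior (ball c R)"
    by (simp add: dist_norm norm_minus_commute)
qed

section \<open>Metric balls as intersections over the frontier\<close>

lemma triangular_ratio_less_iff:
  fixes x y :: "'a::{real_normed_vector, heine_borel}"
  assumes "open G" "frontier G \<noteq> {}" "x \<in> G"
  shows "triangular_ratio G x y < r \<longleftrightarrow>
    (\<forall>z\<in>frontier G. norm (x - y) < r * (norm (z - x) + norm (z - y)))"
proof -
  define h where "h = (\<lambda>z. norm (z - x) + norm (z - y))"
  let ?g = "\<lambda>z. norm (x - y) / h z"
  obtain z1 where z1: "z1 \<in> frontier G"
    using assms by blast
  have pos: "0 < h z" if "z \<in> frontier G" for z
  proof -
    have "z \<noteq> x"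
      using that assms by (auto simp: frontier_def interior_open)
    then show ?thesis
      by (simp add: h_def add_pos_nonneg)
  qed
  \<comment> \<open>Outside this ball \<open>norm (z - x)\<close> alone already exceeds
    \<open>h z1\<close>, so minimising \<open>h\<close> over a compact piece of the frontier is
    enough.\<close>
  have "compact (frontier G \<inter> cball x (h z1))"
    by (simp add: closed_Int_compact)
  moreover have "z1 \<in> frontier G \<inter> cball x (h z1)"
    using z1 by (simp add: h_def dist_norm norm_minus_commute)
  moreover have "continuous_on (frontier G \<inter> cball x (h z1)) h"
    unfolding h_def by (intro continuous_intros)
  ultimately obtain z0 where z0: "z0 \<in> frontier G"
    and z0_min: "\<And>z. z \<in> frontier G \<inter> cball x (h z1) \<Longrightarrow> h z0 \<le> h z"
    using continuous_attains_inf[of "frontier G \<inter> cball x (h z1)" h] by blast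
  have min: "h z0 \<le> h z" if "z \<in> frontier G" for z
  proof (cases "z \<in> cball x (h z1)")
    case False
    then have "h z1 \<le> norm (z - x)"
      by (simp add: dist_norm norm_minus_commute)
    also have "\<dots> \<le> h z"
      by (simp add: h_def)
    finally show ?thesis
      using z0_min[of z1] z1 by (force simp: h_def dist_norm norm_minus_commute)
  qed (use that z0_min in blast)
  have "triangular_ratio G x y = (SUP z\<in>frontier G. ?g z)"
    by (simp add: triangular_ratio_def h_def)
  also have "\<dots> = ?g z0"
    using z0 min pos by (intro cSup_eq_maximum) (auto intro!: divide_left_mono)
  finally have "triangular_ratio G x y = ?g z0" .
  then have "triangular_ratio G x y < r \<longleftrightarrow> norm (x - y) < r * h z0"
    using pos[OF z0] by (simp add: pos_divide_less_eq)
  also have "\<dots> \<longleftrightarrow> (\<forall>z\<in>frontier G. norm (x - y) < r * h z)"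
  proof
    assume *: "norm (x - y) < r * h z0"
    then have "0 < r"
      by (metis norm_ge_zero order_le_less_trans pos z0 zero_less_mult_pos2)
    then show "\<forall>z\<in>frontier G. norm (x - y) < r * h z"
      using * min by (meson less_le_trans mult_left_mono less_imp_le)
  qed (use z0 in blast)
  finally show ?thesis
    by (simp add: h_def)
qed

lemma segment_meets_frontier:
  fixes x y :: "'a::real_normed_vector"
  assumes "x \<in> G" "y \<notin> G"
  obtains z where "z \<in> frontier G" "z \<in> closed_segment x y"
  using connected_Int_frontier[of "closed_segment x y" G] assms by auto

lemma norm_diff_segment:
  fixes x y :: "'a::real_normed_vector"
  assumes "z \<in> closed_segment x y"
  shows "norm (z - x) + norm (z - y) = norm (x - y)"
proof -
  obtain s where s: "0 \<le> s" "s \<le> 1" and z: "z = (1 - s) *\<^sub>R x + s *\<^sub>R y"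
    using assms by (auto simp: in_segment)
  have "z - x = s *\<^sub>R (y - x)" "z - y = (1 - s) *\<^sub>R (x - y)"
    by (simp_all add: z algebra_simps)
  then have "norm (z - x) = s * norm (x - y)" "norm (z - y) = (1 - s) * norm (x - y)"
    using s by (simp_all add: norm_minus_commute)
  then show ?thesis
    by (simp add: algebra_simps)
qed

text \<open>The inequalities alone keep \<open>y\<close> inside \<open>G\<close>: otherwise the
  segment from \<open>x\<close> to \<open>y\<close> meets the frontier in a point whose distances to
  \<open>x\<close> and \<open>y\<close> add up to \<open>norm (x - y)\<close>, and there the
  inequality fails for \<open>r \<le> 1\<close>.\<close>

lemma tr_ball_eq:
  fixes x :: "'a::{real_normed_vector, heine_borel}"
  assumes "open G" "frontier G \<noteq> {}" "x \<in> G" "r \<le> 1"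
  shows "tr_ball G x r = {y. \<forall>z\<in>frontier G. norm (x - y) < r * (norm (z - x) + norm (z - y))}"
proof -
  have "y \<in> G" if *: "\<forall>z\<in>frontier G. norm (x - y) < r * (norm (z - x) + norm (z - y))" for y
  proof (rule ccontr)
    assume "y \<notin> G"
    then obtain z where z: "z \<in> frontier G" "z \<in> closed_segment x y"
      using segment_meets_frontier assms by metis
    then have "norm (x - y) < r * norm (x - y)"
      using * norm_diff_segment by metis
    then show False
      using mult_right_mono[OF \<open>r \<le> 1\<close>, of "norm (x - y)"] by simp
  qed
  then show ?thesis
    using triangular_ratio_less_iff[OF assms(1-3)] by (auto simp: tr_ball_def)
qed

text \<open>Serves to compare a convex domain with the half-spaces containing it, and the punctured
  half-plane with the half-plane.\<close>

lemma tr_ball_mono: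
  fixes x :: "'a::{real_normed_vector, heine_borel}"
  assumes "open G" "frontier G \<noteq> {}" "open G'" "frontier G' \<noteq> {}" "G \<subseteq> G'" "x \<in> G"
    "0 \<le> r" "r \<le> 1"
  shows "tr_ball G x r \<subseteq> tr_ball G' x r"
proof
  fix y assume y: "y \<in> tr_ball G x r"
  have G: "norm (x - y) < r * (norm (z - x) + norm (z - y))" if "z \<in> frontier G" for z
    using y that tr_ball_eq[of G x r] assms by auto
  \<comment> \<open>The point \<open>z\<close> is replaced by the point where the segment from \<open>x\<close> leaves \<open>G\<close>.\<close>
  have "norm (x - y) < r * (norm (z - x) + norm (z - y))" if z: "z \<in> frontier G'" for z
  proof -
    have "z \<notin> G"
      using z assms by (auto simp: frontier_def interior_open)
    then obtain z' where z': "z' \<in> frontier G" "z' \<in> closed_segment x z"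
      using segment_meets_frontier assms by metis
    have "norm (z' - y) \<le> norm (z' - z) + norm (z - y)"
      using norm_triangle_ineq[of "z' - z" "z - y"] by simp
    then have "norm (z' - x) + norm (z' - y) \<le> norm (z - x) + norm (z - y)"
      using norm_diff_segment[OF z'(2)] by (simp add: norm_minus_commute)
    then show ?thesis
      using G[OF z'(1)] \<open>0 \<le> r\<close> by (meson less_le_trans mult_left_mono)
  qed
  then show "y \<in> tr_ball G' x r"
    using tr_ball_eq[of G' x r] assms by auto
qed

section \<open>Cartesian ovals and their convexity\<close>

text \<open>Both sides are nonnegative, so squaring is an equivalence. The non-strict form is needed
  for points in the closure of an oval.\<close>

lemma oval_iff:
  fixes w p :: "'a::real_inner"
  assumes "0 < r"
  shows "norm (w - p) < r * (norm w + norm p) \<longleftrightarrow>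
      (1 - r\<^sup>2) * (norm p)\<^sup>2 - 2 * r\<^sup>2 * norm w * norm p + (1 - r\<^sup>2) * (norm w)\<^sup>2 < 2 * (w \<bullet> p)"
    and "norm (w - p) \<le> r * (norm w + norm p) \<longleftrightarrow>
      (1 - r\<^sup>2) * (norm p)\<^sup>2 - 2 * r\<^sup>2 * norm w * norm p + (1 - r\<^sup>2) * (norm w)\<^sup>2 \<le> 2 * (w \<bullet> p)"
proof -
  have *: "0 \<le> r * (norm w + norm p)"
    using assms by simp
  have sq: "(norm (w - p))\<^sup>2 = (norm w)\<^sup>2 - 2 * (w \<bullet> p) + (norm p)\<^sup>2"
    by (simp add: power2_norm_eq_inner inner_simps inner_commute)
  have le: "norm (w - p) \<le> r * (norm w + norm p)
      \<longleftrightarrow> (norm (w - p))\<^sup>2 \<le> (r * (norm w + norm p))\<^sup>2"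
    using power_mono_iff[OF norm_ge_zero[of "w - p"] * , of 2] by simp
  have lt: "norm (w - p) < r * (norm w + norm p)
      \<longleftrightarrow> (norm (w - p))\<^sup>2 < (r * (norm w + norm p))\<^sup>2"
    using power_mono_iff[OF * norm_ge_zero[of "w - p"], of 2] by (meson not_le zero_less_numeral)
  show "norm (w - p) < r * (norm w + norm p) \<longleftrightarrow>
      (1 - r\<^sup>2) * (norm p)\<^sup>2 - 2 * r\<^sup>2 * norm w * norm p + (1 - r\<^sup>2) * (norm w)\<^sup>2 < 2 * (w \<bullet> p)"
    unfolding lt sq by (simp add: power2_eq_square algebra_simps)
  show "norm (w - p) \<le> r * (norm w + norm p) \<longleftrightarrow>
      (1 - r\<^sup>2) * (norm p)\<^sup>2 - 2 * r\<^sup>2 * norm w * norm p + (1 - r\<^sup>2) * (norm w)\<^sup>2 \<le> 2 * (w \<bullet> p)"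
    unfolding le sq by (simp add: power2_eq_square algebra_simps)
qed

text \<open>Multiplying the squared oval inequality by \<open>1 - r\<^sup>2\<close> allows
  completing the square in \<open>norm p\<close>; the square is then dropped.\<close>

lemma oval_half_space:
  fixes w p :: "'a::real_inner"
  assumes "0 < r" "r \<le> 1/2" "norm (w - p) \<le> r * (norm w + norm p)"
  shows "(1 - 2 * r\<^sup>2) * (norm w)\<^sup>2 \<le> 2 * (1 - r\<^sup>2) * (w \<bullet> p)"
proof -
  have r2: "r\<^sup>2 < 1"
    using assms by (simp add: power_less_one_iff)
  have "((1 - r\<^sup>2) * norm p - r\<^sup>2 * norm w)\<^sup>2 + (1 - 2 * r\<^sup>2) * (norm w)\<^sup>2
    = (1 - r\<^sup>2) * ((1 - r\<^sup>2) * (norm p)\<^sup>2 - 2 * r\<^sup>2 * norm w * norm p + (1 - r\<^sup>2) * (norm w)\<^sup>2)"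
    by (simp add: power2_eq_square algebra_simps)
  also have "\<dots> \<le> (1 - r\<^sup>2) * (2 * (w \<bullet> p))"
    using assms r2 oval_iff(2)[of r w p] by (intro mult_left_mono) auto
  finally have "((1 - r\<^sup>2) * norm p - r\<^sup>2 * norm w)\<^sup>2 + (1 - 2 * r\<^sup>2) * (norm w)\<^sup>2
      \<le> 2 * (1 - r\<^sup>2) * (w \<bullet> p)"
    by (simp only: ac_simps)
  then show ?thesis
    using zero_le_power2[of "(1 - r\<^sup>2) * norm p - r\<^sup>2 * norm w"] by linarith
qed

text \<open>The quadratic term of \<open>F\<close> gains \<open>(1 - r\<^sup>2) * D\<close> in
  convexity, and the concave term in \<open>norm v\<close> loses
  \<open>2 * r\<^sup>2 * norm w * (N - norm m)\<close>. As \<open>D\<close> is at least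
  \<open>(N + norm m) * (N - norm m)\<close>, the gain wins once
  \<open>2 * r\<^sup>2 * norm w \<le> (1 - r\<^sup>2) * (N + norm m)\<close>, and the half-space
  bound keeps \<open>m\<close> far enough from the origin for that.\<close>

lemma oval_convex_comb:
  fixes w p q :: "'a::real_inner"
  assumes r: "0 < r" "r \<le> 1/2" and w: "w \<noteq> 0" and s: "0 \<le> s" "s \<le> 1"
    and p: "norm (w - p) \<le> r * (norm w + norm p)"
    and q: "norm (w - q) \<le> r * (norm w + norm q)"
  defines "F \<equiv> (\<lambda>v. (1 - r\<^sup>2) * (norm v)\<^sup>2 - 2 * r\<^sup>2 * norm w * norm v - 2 * (w \<bullet> v))"
    and "m \<equiv> (1 - s) *\<^sub>R p + s *\<^sub>R q"
  shows "F m \<le> (1 - s) * F p + s * F q"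
    and "r < 1/2 \<Longrightarrow> 0 < s \<Longrightarrow> s < 1 \<Longrightarrow> p \<noteq> q \<Longrightarrow> F m < (1 - s) * F p + s * F q"
proof -
  define N where "N = (1 - s) * norm p + s * norm q"
  define D where "D = s * (1 - s) * (norm (p - q))\<^sup>2"
  have r2: "r\<^sup>2 \<le> 1/4" "r < 1/2 \<Longrightarrow> r\<^sup>2 < 1/4"
    using r power_mono[of r "1/2" 2] power_strict_mono[of r "1/2" 2]
    by (auto simp: power2_eq_square)
  have mN: "norm m \<le> N"
    unfolding m_def N_def using s by (intro order.trans[OF norm_triangle_ineq]) simp
  have ND: "N\<^sup>2 - (norm m)\<^sup>2 \<le> D"
    unfolding N_def m_def D_def using convex_comb_norm_power2_diff_le s by blast
  have D: "D = (1 - s) * (norm p)\<^sup>2 + s * (norm q)\<^sup>2 - (norm m)\<^sup>2"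
    unfolding D_def m_def norm_convex_comb_power2 ..
  have "w \<bullet> m = (1 - s) * (w \<bullet> p) + s * (w \<bullet> q)"
    by (simp add: m_def inner_simps)
  then have F: "(1 - s) * F p + s * F q - F m
      = (1 - r\<^sup>2) * D - 2 * r\<^sup>2 * norm w * (N - norm m)"
    by (simp add: F_def N_def D algebra_simps)
  \<comment> \<open>The half-space bound is linear in the point, so it passes from \<open>p\<close>
    and \<open>q\<close> to \<open>m\<close>; Cauchy-Schwarz turns it into a lower bound for
    \<open>norm m\<close>.\<close>
  have "(1 - 2 * r\<^sup>2) * (norm w)\<^sup>2
      = (1 - s) * ((1 - 2 * r\<^sup>2) * (norm w)\<^sup>2) + s * ((1 - 2 * r\<^sup>2) * (norm w)\<^sup>2)"
    by (simp add: algebra_simps)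
  also have "\<dots> \<le> (1 - s) * (2 * (1 - r\<^sup>2) * (w \<bullet> p)) + s * (2 * (1 - r\<^sup>2) * (w \<bullet> q))"
    using s oval_half_space[OF r p] oval_half_space[OF r q]
    by (intro add_mono mult_left_mono) auto
  also have "\<dots> = 2 * (1 - r\<^sup>2) * (w \<bullet> m)"
    by (simp add: m_def inner_simps algebra_simps)
  also have "\<dots> \<le> 2 * (1 - r\<^sup>2) * (norm w * norm m)"
    using r2 norm_cauchy_schwarz by (intro mult_left_mono) auto
  finally have "norm w * ((1 - 2 * r\<^sup>2) * norm w) \<le> norm w * (2 * (1 - r\<^sup>2) * norm m)"
    by (simp add: power2_eq_square mult_ac)
  then have *: "(1 - 2 * r\<^sup>2) * norm w \<le> 2 * (1 - r\<^sup>2) * norm m"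
    using w by simp
  have dbl: "2 * (1 - r\<^sup>2) * norm m \<le> (1 - r\<^sup>2) * (N + norm m)"
    using mult_left_mono[of "2 * norm m" "N + norm m" "1 - r\<^sup>2"] mN r2
    by (simp add: mult_ac)
  \<comment> \<open>The threshold 1/2 comes from here: the comparison amounts to
    \<open>4 * r\<^sup>2 \<le> 1\<close>.\<close>
  have "2 * r\<^sup>2 * norm w \<le> (1 - 2 * r\<^sup>2) * norm w"
    using r2 by (intro mult_right_mono) auto
  also note *
  also have "2 * (1 - r\<^sup>2) * norm m \<le> (1 - r\<^sup>2) * (N + norm m)"
    using dbl .
  finally have "2 * r\<^sup>2 * norm w * (N - norm m) \<le> (1 - r\<^sup>2) * (N + norm m) * (N - norm m)"
    using mN by (intro mult_right_mono) auto
  also have "\<dots> = (1 - r\<^sup>2) * (N\<^sup>2 - (norm m)\<^sup>2)"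
    by (simp add: power2_eq_square algebra_simps)
  also have ND': "\<dots> \<le> (1 - r\<^sup>2) * D"
    using ND r2 by (intro mult_left_mono) auto
  finally show "F m \<le> (1 - s) * F p + s * F q"
    using F by simp
  assume strict: "r < 1/2" "0 < s" "s < 1" "p \<noteq> q"
  have "2 * r\<^sup>2 * norm w * (N - norm m) < (1 - r\<^sup>2) * D"
  \<comment> \<open>Strictness has two sources. If \<open>norm m = N\<close>, the loss vanishes
    while \<open>p \<noteq> q\<close> makes \<open>D\<close> positive; otherwise
    \<open>N - norm m\<close> is positive and \<open>r < 1/2\<close> makes the comparison of
    coefficients strict.\<close>
  proof (cases "norm m = N")
    case True
    then show ?thesis
      using strict r2 by (simp add: D_def)
  next
    case False
    have "2 * r\<^sup>2 * norm w < (1 - 2 * r\<^sup>2) * norm w"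
      using r2 strict w by (intro mult_strict_right_mono) auto
    also note *
    also have "2 * (1 - r\<^sup>2) * norm m \<le> (1 - r\<^sup>2) * (N + norm m)"
      using dbl .
    finally have "2 * r\<^sup>2 * norm w * (N - norm m) < (1 - r\<^sup>2) * (N + norm m) * (N - norm m)"
      using mN False by (intro mult_strict_right_mono) auto
    also have "\<dots> = (1 - r\<^sup>2) * (N\<^sup>2 - (norm m)\<^sup>2)"
      by (simp add: power2_eq_square algebra_simps)
    also note ND'
    finally show ?thesis .
  qed
  then show "F m < (1 - s) * F p + s * F q"
    using F by simp
qed

definition oval :: "'a::real_normed_vector \<Rightarrow> 'a \<Rightarrow> real \<Rightarrow> 'a set" where
  "oval z x r = {y. norm (x - y) < r * (norm (z - x) + norm (z - y))}"

text \<open>Taking \<open>z\<close> as the origin and collecting the constant on the right exhibits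
  the oval as a sublevel set of the function \<open>F\<close> of
  \<open>oval_convex_comb\<close>.\<close>

lemma mem_oval_iff:
  fixes x z :: "'a::real_inner"
  assumes "0 < r"
  shows "y \<in> oval z x r \<longleftrightarrow>
    (1 - r\<^sup>2) * (norm (y - z))\<^sup>2 - 2 * r\<^sup>2 * norm (x - z) * norm (y - z)
      - 2 * ((x - z) \<bullet> (y - z)) < - ((1 - r\<^sup>2) * (norm (x - z))\<^sup>2)"
  using oval_iff(1)[OF assms, of "x - z" "y - z"]
  by (auto simp: oval_def norm_minus_commute)

lemma convex_oval:
  fixes x z :: "'a::real_inner"
  assumes "x \<noteq> z" "0 < r" "r \<le> 1/2"
  shows "convex (oval z x r)"
  unfolding convex_alt
proof (intro ballI allI impI)
  fix p q and s :: real
  assume p: "p \<in> oval z x r" and q: "q \<in> oval z x r" and s: "0 \<le> s \<and> s \<le> 1"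
  let ?m = "(1 - s) *\<^sub>R p + s *\<^sub>R q"
  let ?F = "\<lambda>v. (1 - r\<^sup>2) * (norm v)\<^sup>2 - 2 * r\<^sup>2 * norm (x - z) * norm v - 2 * ((x - z) \<bullet> v)"
  let ?c = "- ((1 - r\<^sup>2) * (norm (x - z))\<^sup>2)"
  have m: "?m - z = (1 - s) *\<^sub>R (p - z) + s *\<^sub>R (q - z)"
    by (simp add: algebra_simps)
  have "?F (?m - z) \<le> (1 - s) * ?F (p - z) + s * ?F (q - z)"
    unfolding m using assms s p q
    by (intro oval_convex_comb(1)) (auto simp: oval_def norm_minus_commute)
  also have "\<dots> < ?c"
    using p q s unfolding mem_oval_iff[OF \<open>0 < r\<close>] by (intro convex_bound_lt) auto
  finally show "?m \<in> oval z x r"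
    unfolding mem_oval_iff[OF \<open>0 < r\<close>] .
qed

lemma open_oval: "open (oval z x r)"
  unfolding oval_def by (intro open_Collect_less continuous_intros)

lemma strictly_convex_oval:
  fixes x z :: "'a::real_inner"
  assumes "x \<noteq> z" "0 < r" "r < 1/2"
  shows "strictly_convex (oval z x r)"
  unfolding strictly_convex_def
proof (intro ballI impI subsetI)
  fix p q m
  assume pq: "p \<in> closure (oval z x r)" "q \<in> closure (oval z x r)" "p \<noteq> q"
    and m: "m \<in> open_segment p q"
  let ?F = "\<lambda>v. (1 - r\<^sup>2) * (norm v)\<^sup>2 - 2 * r\<^sup>2 * norm (x - z) * norm v - 2 * ((x - z) \<bullet> v)"
  let ?c = "- ((1 - r\<^sup>2) * (norm (x - z))\<^sup>2)"
  obtain s where s: "0 < s" "s < 1" "m = (1 - s) *\<^sub>R p + s *\<^sub>R q"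
    using m by (auto simp: in_segment)
  \<comment> \<open>The end points satisfy only the non-strict inequality; the strict convexity of
    \<open>F\<close> makes it strict at \<open>m\<close>.\<close>
  have "closed {y. norm (x - y) \<le> r * (norm (z - x) + norm (z - y))}"
    by (intro closed_Collect_le continuous_intros)
  then have "closure (oval z x r) \<subseteq> {y. norm (x - y) \<le> r * (norm (z - x) + norm (z - y))}"
    by (intro closure_minimal) (auto simp: oval_def)
  then have pq': "norm (x - z - (p - z)) \<le> r * (norm (x - z) + norm (p - z))"
    "norm (x - z - (q - z)) \<le> r * (norm (x - z) + norm (q - z))"
    using pq by (auto simp: norm_minus_commute)
  have m': "m - z = (1 - s) *\<^sub>R (p - z) + s *\<^sub>R (q - z)"
    by (simp add: s algebra_simps)
  have "?F (m - z) < (1 - s) * ?F (p - z) + s * ?F (q - z)"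
    unfolding m' using assms s pq pq' by (intro oval_convex_comb(2)) auto
  also have "\<dots> \<le> ?c"
    using s pq' unfolding oval_iff(2)[OF \<open>0 < r\<close>] by (intro convex_bound_le) auto
  finally have "m \<in> oval z x r"
    unfolding mem_oval_iff[OF \<open>0 < r\<close>] .
  then show "m \<in> interior (oval z x r)"
    using open_oval interior_open by metis
qed


section \<open>Reflection in a hyperplane and the balls of a half-space\<close>

text \<open>The left side is the squared distance from \<open>x\<close> to the mirror image
  \<open>y'\<close> of \<open>y\<close>. Points of the hyperplane are equidistant from
  \<open>y\<close> and \<open>y'\<close>, so this is the triangle inequality.\<close>

lemma half_space_reflection_le:
  fixes u x y z :: "'a::real_inner"
  assumes u: "norm u = 1" and z: "u \<bullet> z = b"
  shows "(norm (x - y))\<^sup>2 + 4 * (u \<bullet> x - b) * (u \<bullet> y - b) \<le> (norm (z - x) + norm (z - y))\<^sup>2"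
proof -
  define y' where "y' = y - (2 * (u \<bullet> y - b)) *\<^sub>R u"
  have uu: "u \<bullet> u = 1"
    using u by (simp add: norm_eq_1)
  have "(norm (z - y'))\<^sup>2 = (norm (z - y))\<^sup>2"
    unfolding power2_norm_eq_inner y'_def using uu z
    by (simp add: inner_add inner_diff inner_commute) (simp add: algebra_simps)
  then have zy: "norm (z - y') = norm (z - y)"
    by simp
  have "(norm (x - y))\<^sup>2 + 4 * (u \<bullet> x - b) * (u \<bullet> y - b) = (norm (x - y'))\<^sup>2"
    unfolding power2_norm_eq_inner y'_def using uu
    by (simp add: inner_add inner_diff inner_commute) (simp add: algebra_simps)
  also have "\<dots> \<le> (norm (z - x) + norm (z - y'))\<^sup>2"
    using norm_triangle_ineq[of "x - z" "z - y'"]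
    by (intro power_mono) (simp_all add: norm_minus_commute)
  finally show ?thesis
    unfolding zy .
qed

text \<open>\<open>x\<close> and \<open>y'\<close> lie on opposite sides, so their segment crosses
  the hyperplane, and at the crossing the triangle inequality is an equality.\<close>

lemma half_space_reflection_attained:
  fixes u x y :: "'a::real_inner"
  assumes u: "norm u = 1" and x: "b < u \<bullet> x" and y: "b < u \<bullet> y"
  obtains z where "u \<bullet> z = b"
    "(norm (z - x) + norm (z - y))\<^sup>2 = (norm (x - y))\<^sup>2 + 4 * (u \<bullet> x - b) * (u \<bullet> y - b)"
proof -
  define y' where "y' = y - (2 * (u \<bullet> y - b)) *\<^sub>R u"
  have uu: "u \<bullet> u = 1"
    using u by (simp add: norm_eq_1)
  have uy': "u \<bullet> y' = 2 * b - u \<bullet> y"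
    by (simp add: y'_def inner_simps uu)
  obtain z where z: "z \<in> closed_segment x y'" "u \<bullet> z = b"
    using connected_ivt_hyperplane[of "closed_segment x y'" y' x u b] x y uy' by auto
  have "(norm (z - y'))\<^sup>2 = (norm (z - y))\<^sup>2"
    unfolding power2_norm_eq_inner y'_def using uu z
    by (simp add: inner_add inner_diff inner_commute) (simp add: algebra_simps)
  then have "norm (z - y') = norm (z - y)"
    by simp
  then have "norm (z - x) + norm (z - y) = norm (x - y')"
    using norm_diff_segment[OF z(1)] by simp
  also have "(norm (x - y'))\<^sup>2 = (norm (x - y))\<^sup>2 + 4 * (u \<bullet> x - b) * (u \<bullet> y - b)"
    unfolding power2_norm_eq_inner y'_def using uu
    by (simp add: inner_add inner_diff inner_commute) (simp add: algebra_simps)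
  finally show ?thesis
    using that z(2) by blast
qed

text \<open>The right side is the squared Apollonian condition that \<open>norm (x - y)\<close> is
  less than \<open>r\<close> times the distance from \<open>x\<close> to the mirror image of
  \<open>y\<close>; completing the square yields centre and radius.\<close>

lemma half_space_ball_iff:
  fixes u x y :: "'a::real_inner"
  assumes u: "norm u = 1" and x: "b < u \<bullet> x" and r: "0 < r" "r < 1"
  shows "y \<in> ball (x + (2 * r\<^sup>2 * (u \<bullet> x - b) / (1 - r\<^sup>2)) *\<^sub>R u) (2 * (u \<bullet> x - b) * r / (1 - r\<^sup>2))
    \<longleftrightarrow> (norm (x - y))\<^sup>2 < r\<^sup>2 * ((norm (x - y))\<^sup>2 + 4 * (u \<bullet> x - b) * (u \<bullet> y - b))"
proof -
  define d where "d = u \<bullet> x - b"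
  define R where "R = 2 * d * r / (1 - r\<^sup>2)"
  have r2: "0 < 1 - r\<^sup>2"
    using r by (simp add: power_less_one_iff)
  have uu: "u \<bullet> u = 1"
    using u by (simp add: norm_eq_1)
  have "0 \<le> R"
    using r2 x r by (simp add: R_def d_def)
  have R: "(1 - r\<^sup>2) * R = 2 * d * r"
    using r2 by (simp add: R_def)
  \<comment> \<open>The centre is shifted from \<open>x\<close> by \<open>r\<close> times the
    radius, so the computation can run on \<open>R\<close> and the relation \<open>R\<close> without
    fractions.\<close>
  have c: "2 * r\<^sup>2 * d / (1 - r\<^sup>2) = r * R"
    by (simp add: R_def power2_eq_square)
  have "(norm (x + (r * R) *\<^sub>R u - y))\<^sup>2 = (norm (x - y))\<^sup>2 + 2 * r * R * (u \<bullet> x - u \<bullet> y) + r\<^sup>2 * R\<^sup>2"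
    unfolding power2_norm_eq_inner using uu
    by (simp add: inner_add inner_diff inner_commute) (simp add: algebra_simps power2_eq_square)
  then have "R\<^sup>2 - (norm (x + (r * R) *\<^sub>R u - y))\<^sup>2
      = R * ((1 - r\<^sup>2) * R) - 2 * r * R * (u \<bullet> x - u \<bullet> y) - (norm (x - y))\<^sup>2"
    by (simp add: algebra_simps power2_eq_square)
  also have "\<dots> = 2 * r * R * (u \<bullet> y - b) - (norm (x - y))\<^sup>2"
    unfolding R by (simp add: d_def algebra_simps)
  finally have "(1 - r\<^sup>2) * (R\<^sup>2 - (norm (x + (r * R) *\<^sub>R u - y))\<^sup>2)
      = (1 - r\<^sup>2) * (2 * r * R * (u \<bullet> y - b) - (norm (x - y))\<^sup>2)"
    by simp
  also have "\<dots> = 2 * r * ((1 - r\<^sup>2) * R) * (u \<bullet> y - b) - (1 - r\<^sup>2) * (norm (x - y))\<^sup>2"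
    by (simp add: algebra_simps)
  also have "\<dots> = r\<^sup>2 * ((norm (x - y))\<^sup>2 + 4 * d * (u \<bullet> y - b)) - (norm (x - y))\<^sup>2"
    unfolding R by (simp add: algebra_simps power2_eq_square)
  finally have *: "(1 - r\<^sup>2) * (R\<^sup>2 - (norm (x + (r * R) *\<^sub>R u - y))\<^sup>2)
      = r\<^sup>2 * ((norm (x - y))\<^sup>2 + 4 * d * (u \<bullet> y - b)) - (norm (x - y))\<^sup>2" .
  have "norm (x + (r * R) *\<^sub>R u - y) < R \<longleftrightarrow> (norm (x + (r * R) *\<^sub>R u - y))\<^sup>2 < R\<^sup>2"
    using power_mono_iff[OF \<open>0 \<le> R\<close> norm_ge_zero[of "x + (r * R) *\<^sub>R u - y"], of 2]
    by (meson not_le zero_less_numeral)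
  also have "\<dots> \<longleftrightarrow> 0 < (1 - r\<^sup>2) * (R\<^sup>2 - (norm (x + (r * R) *\<^sub>R u - y))\<^sup>2)"
    using r2 by (simp add: zero_less_mult_iff)
  finally show ?thesis
    unfolding * d_def[symmetric] c R_def[symmetric] by (simp add: dist_norm)
qed

text \<open>One inclusion tests only the hyperplane point where the reflected distance is attained;
  the other uses that this distance bounds the sum at every hyperplane point from below.\<close>

lemma tr_ball_half_space:
  fixes u x :: "'a::euclidean_space"
  assumes u: "norm u = 1" and x: "b < u \<bullet> x" and r: "0 < r" "r < 1"
  shows "tr_ball {p. b < u \<bullet> p} x r =
    ball (x + (2 * r\<^sup>2 * (u \<bullet> x - b) / (1 - r\<^sup>2)) *\<^sub>R u) (2 * (u \<bullet> x - b) * r / (1 - r\<^sup>2))"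
    (is "_ = ?B")
proof -
  have fr: "frontier {p. b < u \<bullet> p} = {p. u \<bullet> p = b}"
    using u by (intro frontier_halfspace_gt) auto
  have "b *\<^sub>R u \<in> {p. u \<bullet> p = b}"
    using u by (simp add: norm_eq_1)
  then have ne: "frontier {p. b < u \<bullet> p} \<noteq> {}"
    unfolding fr by blast
  have eq: "tr_ball {p. b < u \<bullet> p} x r =
      {y. \<forall>z. u \<bullet> z = b \<longrightarrow> norm (x - y) < r * (norm (z - x) + norm (z - y))}"
    using tr_ball_eq[OF open_halfspace_gt ne, of x r] x r by (simp add: fr)
  show ?thesis
  proof (intro equalityI subsetI)
    fix y assume y: "y \<in> tr_ball {p. b < u \<bullet> p} x r"
    then have "b < u \<bullet> y"
      by (simp add: tr_ball_def)
    then obtain z where z: "u \<bullet> z = b" "(norm (z - x) + norm (z - y))\<^sup>2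
        = (norm (x - y))\<^sup>2 + 4 * (u \<bullet> x - b) * (u \<bullet> y - b)"
      using half_space_reflection_attained[OF u x] by blast
    have "norm (x - y) < r * (norm (z - x) + norm (z - y))"
      using y z(1) by (auto simp: eq)
    then have "(norm (x - y))\<^sup>2 < r\<^sup>2 * (norm (z - x) + norm (z - y))\<^sup>2"
      unfolding power_mult_distrib[symmetric] by (intro power_strict_mono) auto
    then show "y \<in> ?B"
      unfolding half_space_ball_iff[OF u x r] z(2) .
  next
    fix y assume "y \<in> ?B"
    then have y: "(norm (x - y))\<^sup>2 < r\<^sup>2 * ((norm (x - y))\<^sup>2 + 4 * (u \<bullet> x - b) * (u \<bullet> y - b))"
      unfolding half_space_ball_iff[OF u x r] .
    have "norm (x - y) < r * (norm (z - x) + norm (z - y))" if z: "u \<bullet> z = b" for z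
    proof -
      have "(norm (x - y))\<^sup>2 < r\<^sup>2 * (norm (z - x) + norm (z - y))\<^sup>2"
        using y half_space_reflection_le[OF u z, of x y]
        by (meson less_le_trans mult_left_mono zero_le_power2)
      then have "(norm (x - y))\<^sup>2 < (r * (norm (z - x) + norm (z - y)))\<^sup>2"
        by (simp add: power_mult_distrib)
      then show ?thesis
        using r by (simp add: power2_less_imp_less)
    qed
    then show "y \<in> tr_ball {p. b < u \<bullet> p} x r"
      by (simp add: eq)
  qed
qed

section \<open>Balls of arbitrary open sets and of convex domains\<close>

lemma convex_tr_ball_le_half:
  fixes G :: "'a::euclidean_space set"
  assumes "open G" "G \<noteq> UNIV" "x \<in> G" "0 < r" "r \<le> 1/2"
  shows "convex (tr_ball G x r)"
proof -
  have "frontier G \<noteq> {}"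
    using assms frontier_eq_empty by blast
  then have "tr_ball G x r = (\<Inter>z\<in>frontier G. oval z x r)"
    using assms by (subst tr_ball_eq) (auto simp: oval_def)
  moreover have "x \<noteq> z" if "z \<in> frontier G" for z
    using that assms by (auto simp: frontier_def interior_open)
  ultimately show ?thesis
    using assms by (auto intro!: convex_INT convex_oval)
qed

text \<open>The ball lies in those of all half-spaces containing \<open>G\<close> by monotonicity.
  Conversely, a frontier point of \<open>G\<close> lies on a supporting hyperplane, hence on the
  frontier of one of these half-spaces, whose ball supplies the inequality at that point.\<close>

lemma convex_tr_ball_convex_domain:
  fixes G :: "'a::euclidean_space set"
  assumes G: "open G" "convex G" "G \<noteq> UNIV" "x \<in> G" and r: "0 < r" "r < 1"
  shows "convex (tr_ball G x r)"
proof -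
  define A where "A = {(u, b). norm u = 1 \<and> G \<subseteq> {p. b < u \<bullet> p}}"
  have ne: "frontier G \<noteq> {}"
    using G frontier_eq_empty by blast
  have fr: "frontier {p. b < u \<bullet> p} = {p. u \<bullet> p = b}" if "norm u = 1" for u :: 'a and b
    using that by (intro frontier_halfspace_gt) auto
  have fr_ne: "frontier {p. b < u \<bullet> p} \<noteq> {}" if "norm u = 1" for u :: 'a and b
  proof -
    have "b *\<^sub>R u \<in> {p. u \<bullet> p = b}"
      using that by (simp add: norm_eq_1)
    then show ?thesis
      unfolding fr[OF that] by blast
  qed
  have "tr_ball G x r = (\<Inter>(u, b)\<in>A. tr_ball {p. b < u \<bullet> p} x r)"
  proof (intro equalityI subsetI)
    fix y assume y: "y \<in> tr_ball G x r"
    have "y \<in> tr_ball {p. b < u \<bullet> p} x r" if "norm u = 1" "G \<subseteq> {p. b < u \<bullet> p}" for u b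
      using tr_ball_mono[OF G(1) ne open_halfspace_gt fr_ne[OF that(1)] that(2) G(4), of r] r y
      by auto
    then show "y \<in> (\<Inter>(u, b)\<in>A. tr_ball {p. b < u \<bullet> p} x r)"
      by (auto simp: A_def)
  next
    fix y assume y: "y \<in> (\<Inter>(u, b)\<in>A. tr_ball {p. b < u \<bullet> p} x r)"
    have "norm (x - y) < r * (norm (z - x) + norm (z - y))" if z: "z \<in> frontier G" for z
    proof -
      have "z \<in> closure G" "z \<notin> rel_interior G"
        using z G by (auto simp: frontier_def interior_open rel_interior_open)
      then obtain a where a: "a \<noteq> 0" "\<And>p. p \<in> rel_interior G \<Longrightarrow> a \<bullet> z < a \<bullet> p"
        using supporting_hyperplane_relative_frontier G(2) by metis
      \<comment> \<open>Normalising the normal vector puts the supporting half-space into the family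
        \<open>A\<close>.\<close>
      let ?u = "sgn a"
      have u: "norm ?u = 1"
        using a by (simp add: norm_sgn)
      have sub: "G \<subseteq> {p. ?u \<bullet> z < ?u \<bullet> p}"
        using a G by (auto simp: sgn_div_norm rel_interior_open divide_strict_right_mono)
      then have "y \<in> tr_ball {p. ?u \<bullet> z < ?u \<bullet> p} x r"
        using y u by (auto simp: A_def)
      then show ?thesis
        using tr_ball_eq[OF open_halfspace_gt fr_ne[OF u], of x "?u \<bullet> z" r] sub G r
        by (auto simp: fr[OF u])
    qed
    then show "y \<in> tr_ball G x r"
      using tr_ball_eq[OF G(1) ne G(4), of r] r by auto
  qed
  moreover have "convex (tr_ball {p. b < u \<bullet> p} x r)" if "(u, b) \<in> A" for u b
    using that G r by (subst tr_ball_half_space) (auto simp: A_def)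
  ultimately show ?thesis
    by (auto intro!: convex_INT)
qed


section \<open>The concrete domains: punctured space, half-space, punctured half-plane,
  polygons\<close>

lemma tr_ball_punctured_space:
  fixes x z :: "'a::euclidean_space"
  assumes "x \<noteq> z" "r \<le> 1"
  shows "tr_ball (UNIV - {z}) x r = oval z x r"
proof -
  have "frontier (UNIV - {z}) = {z}"
    using frontier_complement[of "{z}"] by (simp add: frontier_def Compl_eq_Diff_UNIV)
  then show ?thesis
    using tr_ball_eq[of "UNIV - {z}" x r] assms by (simp add: oval_def open_delete)
qed

lemma upper_half_space_eq: "upper_half_space k = {p. 0 < axis k 1 \<bullet> p}"
  by (simp add: upper_half_space_def inner_axis')

lemma open_upper_half_space: "open (upper_half_space k)"
  unfolding upper_half_space_eq by (rule open_halfspace_gt)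

lemma frontier_upper_half_space: "frontier (upper_half_space k) = {p. p $ k = 0}"
  unfolding upper_half_space_eq
  by (subst frontier_halfspace_gt) (auto simp: inner_axis' axis_eq_0_iff)

lemma tr_ball_upper_half_space:
  assumes x: "x \<in> upper_half_space k" and r: "0 < r" "r < 1"
  shows "tr_ball (upper_half_space k) x r =
    ball (x + (2 * r\<^sup>2 * x $ k / (1 - r\<^sup>2)) *\<^sub>R axis k 1) (2 * x $ k * r / (1 - r\<^sup>2))"
  using tr_ball_half_space[of "axis k 1" 0 x r] assms
  by (simp add: upper_half_space_eq inner_axis')

lemma tr_ball_punctured_half_plane:
  fixes x :: "real ^ 2"
  assumes x: "x \<in> upper_half_space 2" "x $ 2 < \<bar>x $ 1\<bar>" and r: "0 < r"
    "r \<le> (sqrt ((x $ 1)\<^sup>2 + (x $ 2)\<^sup>2) - sqrt 2 * x $ 2) / (\<bar>x $ 1\<bar> + x $ 2)"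
  shows "r < 1"
    and "tr_ball (upper_half_space 2 - {axis 2 1}) x r = tr_ball (upper_half_space 2) x r"
proof -
  let ?H = "upper_half_space 2 :: (real ^ 2) set" and ?G = "upper_half_space 2 - {axis 2 1 :: real ^ 2}"
  define S where "S = \<bar>x $ 1\<bar> + x $ 2"
  define \<sigma> where "\<sigma> = sgn (x $ 1)"
  \<comment> \<open>The mirror image of the puncture in the line
    \<open>p $ 2 = \<sigma> * p $ 1\<close>, which bounds the sector.\<close>
  define e where "e = (axis 1 \<sigma> :: real ^ 2)"
  have x2: "0 < x $ 2"
    using x by (simp add: upper_half_space_def)
  have S: "0 < S"
    using x2 by (simp add: S_def)
  have \<sigma>: "\<sigma> * x $ 1 = \<bar>x $ 1\<bar>" "\<sigma>\<^sup>2 = 1"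
    using x x2 by (auto simp: \<sigma>_def sgn_if)
  have rS: "r * S + sqrt 2 * x $ 2 \<le> sqrt ((x $ 1)\<^sup>2 + (x $ 2)\<^sup>2)"
    using r S by (simp add: S_def[symmetric] pos_le_divide_eq)
  also have "\<dots> \<le> S"
    using sqrt_sum_squares_le_sum_abs[of "x $ 1" "x $ 2"] x2 by (simp add: S_def)
  finally have "r * S < 1 * S"
    using x2 by (smt (verit) mult_pos_pos real_sqrt_gt_zero)
  then show r1: "r < 1"
    using S by simp
  have r2: "0 < 1 - r\<^sup>2"
    using r r1 by (simp add: power_less_one_iff)
  \<comment> \<open>Squaring produces \<open>S\<close> as a common factor of both sides, which
    cancels.\<close>
  have "(r * S + sqrt 2 * x $ 2)\<^sup>2 \<le> (sqrt ((x $ 1)\<^sup>2 + (x $ 2)\<^sup>2))\<^sup>2"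
    using rS r S x2 by (intro power_mono) auto
  then have "S * (r\<^sup>2 * S + 2 * sqrt 2 * r * x $ 2) \<le> \<bar>x $ 1\<bar>\<^sup>2 - (x $ 2)\<^sup>2"
    by (simp add: power2_sum power_mult_distrib) (simp add: power2_eq_square algebra_simps)
  also have "\<dots> = S * (\<bar>x $ 1\<bar> - x $ 2)"
    unfolding S_def power2_eq_square by (simp only: algebra_simps)
  finally have "r\<^sup>2 * S + 2 * sqrt 2 * r * x $ 2 \<le> \<bar>x $ 1\<bar> - x $ 2"
    using S by simp
  \<comment> \<open>Divided by \<open>1 - r\<^sup>2\<close>, this says that the Euclidean centre is
    at least one radius away from the line bounding the sector.\<close>
  then have le: "sqrt 2 * (2 * x $ 2 * r) \<le> (1 - r\<^sup>2) * (\<bar>x $ 1\<bar> - x $ 2) - 2 * r\<^sup>2 * x $ 2"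
    by (simp add: S_def algebra_simps)
  have frG: "frontier ?G \<subseteq> {p. p $ 2 = 0} \<union> {axis 2 1}"
    using frontier_Int_subset[of ?H "- {axis 2 1}"]
    by (simp add: frontier_upper_half_space Diff_eq) (simp add: frontier_def)
  have G: "open ?G" "x \<in> ?G"
    using x by (auto simp: open_upper_half_space open_delete axis_def)
  have Hne: "frontier ?H \<noteq> {}"
    by (auto simp: frontier_upper_half_space intro: exI[of _ 0])
  have Gne: "frontier ?G \<noteq> {}"
    using G(2) by (intro frontier_not_empty) auto
  \<comment> \<open>The line bounding the sector is the perpendicular bisector of \<open>e\<close>
    and the puncture.\<close>
  have closer: "norm (e - p) \<le> norm (axis 2 1 - p)" if "p $ 2 \<le> \<sigma> * p $ 1" for p :: "real ^ 2"
  proof -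
    have "(norm (e - p))\<^sup>2 \<le> (norm (axis 2 1 - p))\<^sup>2"
      using that \<sigma>(2) unfolding power2_norm_eq_inner e_def
      by (simp add: inner_diff inner_commute inner_axis inner_axis_axis power2_eq_square)
    then show ?thesis
      using power2_le_imp_le by auto
  qed
  show "tr_ball ?G x r = tr_ball ?H x r"
  proof (intro equalityI subsetI)
    show "y \<in> tr_ball ?H x r" if "y \<in> tr_ball ?G x r" for y
      using that tr_ball_mono[OF G(1) Gne open_upper_half_space Hne _ G(2), of r] r r1 by auto
  next
    fix y assume y: "y \<in> tr_ball ?H x r"
    have H: "norm (x - y) < r * (norm (z - x) + norm (z - y))" if "z $ 2 = 0" for z
      using y that tr_ball_eq[OF open_upper_half_space Hne x(1), of r] r1
      by (auto simp: frontier_upper_half_space)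
    define c where "c = x + (2 * r\<^sup>2 * x $ 2 / (1 - r\<^sup>2)) *\<^sub>R axis 2 1"
    \<comment> \<open>A normal vector of that line, of length \<open>sqrt 2\<close>, pointing into
      the sector; the sector is where \<open>v\<close> has positive inner product.\<close>
    define v where "v = (axis 1 \<sigma> - axis 2 1 :: real ^ 2)"
    have v: "v \<bullet> p = \<sigma> * p $ 1 - p $ 2" for p
      by (simp add: v_def inner_diff inner_axis')
    have "norm v = sqrt 2"
      using \<sigma>(2) unfolding norm_eq_sqrt_inner v by (simp add: v_def axis_def power2_eq_square)
    then have "v \<bullet> (c - y) \<le> sqrt 2 * norm (c - y)"
      using norm_cauchy_schwarz[of v "c - y"] by simp
    also have "\<dots> < sqrt 2 * (2 * x $ 2 * r / (1 - r\<^sup>2))"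
      using y tr_ball_upper_half_space[OF x(1) r(1) r1]
      by (intro mult_strict_left_mono) (simp_all add: c_def dist_norm)
    also have "\<dots> \<le> v \<bullet> c"
    proof -
      have "(1 - r\<^sup>2) * (v \<bullet> c) = (1 - r\<^sup>2) * (\<bar>x $ 1\<bar> - x $ 2) - 2 * r\<^sup>2 * x $ 2"
        unfolding v using r2 \<sigma>(1) by (simp add: c_def axis_def right_diff_distrib distrib_left)
      then have "sqrt 2 * (2 * x $ 2 * r) \<le> (v \<bullet> c) * (1 - r\<^sup>2)"
        using le by (simp only: mult.commute)
      then show ?thesis
        using r2 by (simp add: pos_divide_le_eq)
    qed
    finally have sector: "y $ 2 \<le> \<sigma> * y $ 1"
      by (simp add: v inner_diff_right)
    \<comment> \<open>The inequality at \<open>e\<close> is known because \<open>e\<close> is on the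
      boundary of the half-plane. The puncture is no closer to \<open>x\<close> or to
      \<open>y\<close>, so its inequality follows.\<close>
    have "e $ 2 = 0"
      by (simp add: e_def axis_def)
    then have "norm (x - y) < r * (norm (e - x) + norm (e - y))"
      by (rule H)
    also have "\<dots> \<le> r * (norm (axis 2 1 - x) + norm (axis 2 1 - y))"
      using closer[of x] closer[of y] sector x(2) \<sigma>(1) r(1) by (intro mult_left_mono add_mono) auto
    finally show "y \<in> tr_ball ?G x r"
      using H frG tr_ball_eq[OF G(1) Gne G(2), of r] r1 by auto
  qed
qed

text \<open>The inside of a compact curve is open and bounded, and the plane is unbounded.\<close>

lemma polygon_open_neq_UNIV:
  assumes "polygon P"
  shows "open P" "P \<noteq> UNIV"
proof -
  obtain vs where vs: "simple_path (polygonal_path vs)" "P = inside (path_image (polygonal_path vs))"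
    using assms unfolding polygon_def by blast
  have "closed (path_image (polygonal_path vs))" "bounded (path_image (polygonal_path vs))"
    using vs(1) by (simp_all add: closed_simple_path_image bounded_simple_path_image)
  then show "open P" "P \<noteq> UNIV"
    unfolding vs(2) using open_inside bounded_inside not_bounded_UNIV by metis+
qed



theorem theorem1p2:
  shows "(\<forall>(z :: real ^ 'n) x r. x \<in> UNIV - {z} \<and> 0 < r \<longrightarrow>
            (r \<le> 1/2 \<longrightarrow> convex (tr_ball (UNIV - {z}) x r)) \<and>
            (r < 1/2 \<longrightarrow> strictly_convex (tr_ball (UNIV - {z}) x r)))
       \<and> (\<forall>(k :: 'n) x r. x \<in> upper_half_space k \<and> 0 < r \<and> r < 1 \<longrightarrow>
            tr_ball (upper_half_space k) x r =
              ball (x - (x $ k * (1 - (1 + r\<^sup>2) / (1 - r\<^sup>2))) *\<^sub>R axis k 1)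
                   (2 * x $ k * r / (1 - r\<^sup>2)) \<and>
            strictly_convex (tr_ball (upper_half_space k) x r))
       \<and> (\<forall>(x :: real ^ 2) r. x \<in> upper_half_space 2 - {axis 2 1} \<and> x $ 2 < \<bar>x $ 1\<bar> \<and>
            0 < r \<and> r \<le> (sqrt ((x $ 1)\<^sup>2 + (x $ 2)\<^sup>2) - sqrt 2 * x $ 2) / (\<bar>x $ 1\<bar> + x $ 2) \<longrightarrow>
            convex (tr_ball (upper_half_space 2 - {axis 2 1}) x r))
       \<and> (\<forall>(P :: (real ^ 2) set) x. polygon P \<and> x \<in> P \<longrightarrow>
            (\<forall>r. 0 < r \<and> r \<le> 1/2 \<longrightarrow> convex (tr_ball P x r)) \<and>
            (convex P \<longrightarrow> (\<forall>r. 0 < r \<and> r < 1 \<longrightarrow> convex (tr_ball P x r))))"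
proof (intro conjI allI impI; (elim conjE)?)
  fix z x :: "real ^ 'n" and r :: real
  assume "x \<in> UNIV - {z}" "0 < r" "r \<le> 1/2"
  then show "convex (tr_ball (UNIV - {z}) x r)"
    by (simp add: tr_ball_punctured_space convex_oval)
next
  fix z x :: "real ^ 'n" and r :: real
  assume "x \<in> UNIV - {z}" "0 < r" "r < 1/2"
  then show "strictly_convex (tr_ball (UNIV - {z}) x r)"
    by (simp add: tr_ball_punctured_space strictly_convex_oval)
next
  fix k :: 'n and x :: "real ^ 'n" and r :: real
  assume *: "x \<in> upper_half_space k" "0 < r" "r < 1"
  then have r2: "0 < 1 - r\<^sup>2"
    by (simp add: power_less_one_iff)
  then have "- (x $ k * (1 - (1 + r\<^sup>2) / (1 - r\<^sup>2))) = 2 * r\<^sup>2 * x $ k / (1 - r\<^sup>2)"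
    by (simp add: field_simps)
  then show "tr_ball (upper_half_space k) x r =
      ball (x - (x $ k * (1 - (1 + r\<^sup>2) / (1 - r\<^sup>2))) *\<^sub>R axis k 1) (2 * x $ k * r / (1 - r\<^sup>2))"
    unfolding tr_ball_upper_half_space[OF *] by (metis diff_conv_add_uminus scaleR_minus_left)
  show "strictly_convex (tr_ball (upper_half_space k) x r)"
    unfolding tr_ball_upper_half_space[OF *] using * r2
    by (intro strictly_convex_ball) (simp add: upper_half_space_def)
next
  fix x :: "real ^ 2" and r :: real
  assume "x \<in> upper_half_space 2 - {axis 2 1}" "x $ 2 < \<bar>x $ 1\<bar>" "0 < r"
    "r \<le> (sqrt ((x $ 1)\<^sup>2 + (x $ 2)\<^sup>2) - sqrt 2 * x $ 2) / (\<bar>x $ 1\<bar> + x $ 2)"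
  then show "convex (tr_ball (upper_half_space 2 - {axis 2 1}) x r)"
    using tr_ball_punctured_half_plane[of x r] by (simp add: tr_ball_upper_half_space)
next
  fix P :: "(real ^ 2) set" and x and r :: real
  assume "polygon P" "x \<in> P" "0 < r" "r \<le> 1/2"
  then show "convex (tr_ball P x r)"
    by (simp add: convex_tr_ball_le_half polygon_open_neq_UNIV)
next
  fix P :: "(real ^ 2) set" and x and r :: real
  assume "polygon P" "x \<in> P" "convex P" "0 < r" "r < 1"
  then show "convex (tr_ball P x r)"
    by (simp add: convex_tr_ball_convex_domain polygon_open_neq_UNIV)
qed

end
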